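(* Let $G=(V,E)$ be a connected, locally finite, regular graph. Then $G$, with its path metric, is plastic.
   Context: Graphs are simple, undirected and unweighted. A connected graph is identified with its vertex set and equipped with the path metric $d(u,v)$ = minimal length of a walk from $u$ to $v$. A graph is locally finite if every vertex has finite degree, and regular if all vertices have the same degree. A map $f$ is nonexpansive if $d(f(x),f(y))\le d(x,y)$ for all $x,y$. A metric space is plastic if every bijective nonexpansive self-map is an isometry. *)

theory Defs
  imports "HOL-Analysis.Abstract_Metric_Spaces" "Graph_Theory.Graph_Theory"
begin

text \<open>
  A simple undirected graph, finite or infinite, is a \<^locale>\<open>pair_bidirected_digraph\<close>: the set of
  arcs is a symmetric and irreflexive set of ordered pairs of vertices, an edge \<open>{u, v}\<close> being the
  two arcs \<open>(u, v)\<close> and \<open>(v, u)\<close>. Hence the arcs leaving a vertex correspond to its neighbours, and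
  the degree of a vertex is its out-degree.
\<close>

definition locally_finite_graph :: "('a, 'b) pre_digraph \<Rightarrow> bool" where
  "locally_finite_graph G \<longleftrightarrow> (\<forall>v \<in> verts G. finite (out_arcs G v))"

text \<open>
  \<^const>\<open>out_degree\<close> is a cardinality in \<^typ>\<open>nat\<close>, so a vertex of infinite degree gets the value 0.
  The following is therefore meant for locally finite graphs only.
\<close>

definition regular_graph :: "('a, 'b) pre_digraph \<Rightarrow> bool" where
  "regular_graph G \<longleftrightarrow> (\<forall>u \<in> verts G. \<forall>v \<in> verts G. out_degree G u = out_degree G v)"

text \<open>
  An arc walk is the list of its arcs, so its \<^const>\<open>length\<close> is the number of steps. The
  infimum in \<^typ>\<open>nat\<close> of a nonempty set is its minimum; between vertices of a connected graph
  there is always a walk. If there is none, the value is an unspecified constant.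
\<close>

definition path_dist :: "('a, 'b) pre_digraph \<Rightarrow> 'a \<Rightarrow> 'a \<Rightarrow> real" where
  "path_dist G u v = real (INF p \<in> {p. pre_digraph.awalk G u p v}. length p)"

context Metric_space
begin

definition nonexpansive :: "('a \<Rightarrow> 'a) \<Rightarrow> bool" where
  "nonexpansive f \<longleftrightarrow> f \<in> M \<rightarrow> M \<and> (\<forall>x \<in> M. \<forall>y \<in> M. d (f x) (f y) \<le> d x y)"

definition isometry :: "('a \<Rightarrow> 'a) \<Rightarrow> bool" where
  "isometry f \<longleftrightarrow> bij_betw f M M \<and> (\<forall>x \<in> M. \<forall>y \<in> M. d (f x) (f y) = d x y)"

end

locale plastic_metric_space = Metric_space +
  assumes plastic: "bij_betw f M M \<Longrightarrow> nonexpansive f \<Longrightarrow> isometry f"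

end

theory Submission
  imports Defs
begin

text \<open>
  A nonexpansive bijection \<open>f\<close> sends adjacent vertices to distinct vertices at distance at most 1,
  hence to adjacent vertices. So \<open>f\<close> maps the neighbours of a vertex \<open>v\<close> injectively into the
  neighbours of \<open>f v\<close>. By regularity and local finiteness these two sets are finite of the same
  size, so the map is onto: adjacency of \<open>f v\<close> and \<open>f w\<close> implies adjacency of \<open>v\<close> and \<open>w\<close>
  (\<open>adjacency_preserving_bij_reflects_arcs\<close>). Thus the inverse of \<open>f\<close> preserves adjacency as well.
  A map that preserves adjacency carries walks to walks of the same length, so the inverse of \<open>f\<close>
  is nonexpansive too (\<open>path_dist_image_le\<close>), and \<open>f\<close> is an isometry.
\<close>

lemma path_dist_le_length:
  assumes "pre_digraph.awalk G u p v"
  shows "path_dist G u v \<le> length p"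
  using assms unfolding path_dist_def by (auto intro: cINF_lower)

lemma shortest_walkE:
  assumes "pre_digraph.awalk G u q v"
  obtains p where "pre_digraph.awalk G u p v" "path_dist G u v = length p"
proof -
  have "length ` {p. pre_digraph.awalk G u p v} \<noteq> {}"
    using assms by blast
  then have "(INF p \<in> {p. pre_digraph.awalk G u p v}. length p)
      \<in> length ` {p. pre_digraph.awalk G u p v}"
    by (rule Inf_nat_def1)
  then show thesis
    using that unfolding path_dist_def by auto
qed

lemma (in wf_digraph) strongly_connected_walkE:
  assumes "strongly_connected G" "u \<in> verts G" "v \<in> verts G"
  obtains p where "awalk u p v" "path_dist G u v = length p"
proof -
  obtain q where "awalk u q v"
    using assms by (auto simp: strongly_connected_def reachable_awalk)
  then show thesis
    using that by (rule shortest_walkE)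
qed

lemma (in pair_sym_digraph) length_rev_path [simp]: "length (rev_path p) = length p"
  by (induction p) auto

text \<open>
  Reversal matches the walks from \<open>u\<close> to \<open>v\<close> with those from \<open>v\<close> to \<open>u\<close>, preserving length. If there
  are none, both infima are taken over the empty set and hence equal.
\<close>

lemma (in pair_sym_digraph) path_dist_commute:
  "path_dist (with_proj G) u v = path_dist (with_proj G) v u"
proof -
  have "length ` {p. awalk x p y} \<subseteq> length ` {p. awalk y p x}" for x y
  proof (rule image_subsetI)
    fix p assume "p \<in> {p. awalk x p y}"
    then have "rev_path p \<in> {p. awalk y p x}"
      by simp
    then show "length p \<in> length ` {p. awalk y p x}"
      by (metis image_eqI length_rev_path)
  qed
  then have "length ` {p. awalk u p v} = length ` {p. awalk v p u}"
    by blast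
  then show ?thesis
    by (simp add: path_dist_def)
qed

lemma (in pair_sym_digraph) Metric_space_path_dist:
  assumes "strongly_connected (with_proj G)"
  shows "Metric_space (pverts G) (path_dist (with_proj G))"
proof
  let ?d = "path_dist (with_proj G)"
  note walkE = strongly_connected_walkE[OF assms, simplified]
  show "0 \<le> ?d u v" for u v
    by (simp add: path_dist_def)
  show "?d u v = ?d v u" for u v
    by (rule path_dist_commute)
  show "?d u v = 0 \<longleftrightarrow> u = v" if uv: "u \<in> pverts G" "v \<in> pverts G" for u v
  proof
    assume "?d u v = 0"
    moreover obtain p where "awalk u p v" "?d u v = length p"
      using uv by (rule walkE)
    ultimately show "u = v"
      by (simp add: awalk_empty_ends)
  next
    assume "u = v"
    then have "awalk u [] v"
      using uv by (simp add: awalk_Nil_iff)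
    then show "?d u v = 0"
      using path_dist_le_length[of "with_proj G" u "[]" v] by (simp add: path_dist_def)
  qed
  show "?d u w \<le> ?d u v + ?d v w"
    if uvw: "u \<in> pverts G" "v \<in> pverts G" "w \<in> pverts G" for u v w
  proof -
    obtain p where p: "awalk u p v" "?d u v = length p"
      using uvw(1,2) by (rule walkE)
    obtain q where q: "awalk v q w" "?d v w = length q"
      using uvw(2,3) by (rule walkE)
    show ?thesis
      using path_dist_le_length[OF awalk_appendI[OF p(1) q(1)]] p(2) q(2) by simp
  qed
qed

lemma (in pair_wf_digraph) path_dist_arc_le_1:
  assumes "(u, v) \<in> parcs G"
  shows "path_dist (with_proj G) u v \<le> 1"
proof -
  have "awalk u [(u, v)] v"
    using assms by (simp add: awalk_simps in_arcsD2)
  from path_dist_le_length[OF this] show ?thesis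
    by simp
qed

lemma (in pair_wf_digraph) arc_if_path_dist_le_1:
  assumes "strongly_connected (with_proj G)" "u \<in> pverts G" "v \<in> pverts G"
    and "u \<noteq> v" "path_dist (with_proj G) u v \<le> 1"
  shows "(u, v) \<in> parcs G"
proof -
  obtain p where p: "awalk u p v" "path_dist (with_proj G) u v = length p"
    using strongly_connected_walkE[OF assms(1), simplified, OF assms(2,3)] .
  moreover have "p \<noteq> []"
    using p(1) \<open>u \<noteq> v\<close> by (auto simp: awalk_Nil_iff)
  ultimately obtain e where "p = [e]"
    using assms(5) by (cases p) auto
  then show ?thesis
    using p(1) by (cases e) (auto simp: awalk_simps)
qed

lemma (in pair_wf_digraph) awalk_image:
  assumes "h \<in> pverts G \<rightarrow> pverts G"
    and "\<And>x y. (x, y) \<in> parcs G \<Longrightarrow> (h x, h y) \<in> parcs G"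
    and "awalk u p v"
  shows "awalk (h u) (map (map_prod h h) p) (h v)"
  using assms(3)
proof (induction p arbitrary: u)
  case Nil
  then show ?case
    using assms(1) by (auto simp: awalk_Nil_iff)
next
  case (Cons e p)
  then show ?case
    using assms(2) by (cases e) (auto simp: awalk_Cons_iff)
qed

lemma (in pair_wf_digraph) path_dist_image_le:
  assumes "strongly_connected (with_proj G)"
    and "h \<in> pverts G \<rightarrow> pverts G"
    and "\<And>x y. (x, y) \<in> parcs G \<Longrightarrow> (h x, h y) \<in> parcs G"
    and "u \<in> pverts G" "v \<in> pverts G"
  shows "path_dist (with_proj G) (h u) (h v) \<le> path_dist (with_proj G) u v"
proof -
  obtain p where p: "awalk u p v" "path_dist (with_proj G) u v = length p"
    using strongly_connected_walkE[OF assms(1), simplified, OF assms(4,5)] .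
  show ?thesis
    using path_dist_le_length[OF awalk_image[OF assms(2,3) p(1)]] p(2) by simp
qed

text \<open>
  The counting step: an injection of the arcs leaving \<open>v\<close> into the arcs leaving \<open>f v\<close> is onto,
  because both sets are finite of the same size.
\<close>

lemma (in pair_wf_digraph) adjacency_preserving_bij_reflects_arcs:
  assumes "locally_finite_graph (with_proj G)" "regular_graph (with_proj G)"
    and bij: "bij_betw f (pverts G) (pverts G)"
    and arcs: "\<And>x y. (x, y) \<in> parcs G \<Longrightarrow> (f x, f y) \<in> parcs G"
    and "v \<in> pverts G" "w \<in> pverts G" "(f v, f w) \<in> parcs G"
  shows "(v, w) \<in> parcs G"
proof -
  let ?out = "out_arcs (with_proj G)"
  let ?f = "map_prod f f"
  have inj: "inj_on f (pverts G)" and fv: "f v \<in> pverts G"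
    using bij \<open>v \<in> pverts G\<close> by (auto simp: bij_betw_def)
  have "inj_on ?f (?out v)"
    using map_prod_inj_on[OF inj inj]
    by (rule inj_on_subset) (use wellformed' in auto)
  then have "card (?f ` ?out v) = card (?out v)"
    by (rule card_image)
  also have "\<dots> = card (?out (f v))"
    using \<open>regular_graph _\<close> \<open>v \<in> pverts G\<close> fv
    unfolding regular_graph_def out_degree_def with_proj_simps by blast
  finally have "card (?f ` ?out v) = card (?out (f v))" .
  moreover have "finite (?out (f v))"
    using \<open>locally_finite_graph _\<close> fv by (simp add: locally_finite_graph_def)
  moreover have "?f ` ?out v \<subseteq> ?out (f v)"
    using arcs by auto
  ultimately have "?f ` ?out v = ?out (f v)"
    by (simp add: card_subset_eq)
  moreover have "(f v, f w) \<in> ?out (f v)"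
    using \<open>(f v, f w) \<in> parcs G\<close> by simp
  ultimately have "(f v, f w) \<in> ?f ` ?out v"
    by simp
  then obtain w' where w': "(v, w') \<in> parcs G" "f w' = f w"
    by auto
  then have "w' = w"
    using inj \<open>w \<in> pverts G\<close> by (auto dest: inj_onD wellformed')
  with w' show ?thesis
    by simp
qed

theorem theorem3p5:
  fixes G :: "'a pair_pre_digraph"
  assumes "pair_bidirected_digraph G"
    and "Digraph_Component.connected (with_proj G)"
    and "locally_finite_graph (with_proj G)"
    and "regular_graph (with_proj G)"
  shows "plastic_metric_space (pverts G) (path_dist (with_proj G))"
proof -
  let ?V = "pverts G" and ?d = "path_dist (with_proj G)"
  interpret pair_bidirected_digraph G
    by fact
  have conn: "strongly_connected (with_proj G)"
    using symmetric_connected_imp_strongly_connected sym_arcs assms(2) by blast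
  interpret Metric_space ?V ?d
    using conn by (rule Metric_space_path_dist)
  show ?thesis
  proof
    fix f
    assume bij: "bij_betw f ?V ?V" and "nonexpansive f"
    then have f: "f \<in> ?V \<rightarrow> ?V"
      and le: "\<And>x y. x \<in> ?V \<Longrightarrow> y \<in> ?V \<Longrightarrow> ?d (f x) (f y) \<le> ?d x y"
      by (auto simp: nonexpansive_def)
    have inj: "inj_on f ?V"
      using bij by (rule bij_betw_imp_inj_on)
    let ?g = "inv_into ?V f"
    have g: "?g \<in> ?V \<rightarrow> ?V"
      using bij_betw_inv_into[OF bij] by (rule bij_betw_imp_funcset)
    have f_arcs: "(f x, f y) \<in> parcs G" if xy: "(x, y) \<in> parcs G" for x y
    proof (rule arc_if_path_dist_le_1[OF conn])
      show "f x \<in> ?V" "f y \<in> ?V"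
        using f wellformed'[OF xy] by auto
      show "f x \<noteq> f y"
        using inj_onD[OF inj _ wellformed'[OF xy]] pair_no_loops[OF xy] by auto
      show "?d (f x) (f y) \<le> 1"
        using le[OF wellformed'[OF xy]] path_dist_arc_le_1[OF xy] by linarith
    qed
    have g_arcs: "(?g x, ?g y) \<in> parcs G" if xy: "(x, y) \<in> parcs G" for x y
    proof (rule adjacency_preserving_bij_reflects_arcs[OF assms(3,4) bij f_arcs])
      show "?g x \<in> ?V" "?g y \<in> ?V"
        using g wellformed'[OF xy] by auto
      show "(f (?g x), f (?g y)) \<in> parcs G"
        using xy wellformed'[OF xy] by (simp add: bij_betw_inv_into_right[OF bij])
    qed
    have "?d (f x) (f y) = ?d x y" if xy: "x \<in> ?V" "y \<in> ?V" for x y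
    proof (rule antisym)
      show "?d (f x) (f y) \<le> ?d x y"
        using xy by (rule le)
      have "?d (?g (f x)) (?g (f y)) \<le> ?d (f x) (f y)"
        using f xy by (intro path_dist_image_le[OF conn g g_arcs]) auto
      then show "?d x y \<le> ?d (f x) (f y)"
        using xy by (simp add: bij_betw_inv_into_left[OF bij])
    qed
    with bij show "isometry f"
      by (simp add: isometry_def)
  qed
qed

end
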